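(* Let $\Gamma$ be a $4$-regular infinite planar tessellation with non-negative combinatorial curvature. For $i=1,2$ let $\sigma_i$ be a face of degree $k_i\ge 8$, with $\sigma_1\ne\sigma_2$. Then $U_1(\sigma_1)\cap U_1(\sigma_2)=\emptyset$.
   Context: A planar tessellation is a locally finite, connected, simple graph embedded in $\mathbb S^2$ or $\mathbb R^2$, with faces the components of the complement, such that: (i) every closed face is a closed disk bounded by finitely many edges; (ii) every edge lies in exactly two different closed faces; (iii) two distinct closed faces intersect in the empty set, a single vertex, or the closure of a single edge; all vertex and face degrees (face degree = number of boundary edges) are at least $3$. Infinite means embedded in $\mathbb R^2$. The combinatorial curvature at a vertex $x$ is $\Phi(x)=1-\frac{|x|}{2}+\sum_{\sigma}\frac{1}{|\sigma|}$, summed over faces whose closure contains $x$; non-negative curvature means $\Phi\ge0$ at every vertex. $4$-regular means all vertices have degree $4$. For a face $\sigma$, $\partial\sigma$ is the set of vertices in the closure of $\sigma$, and the $1$-neighborhood is $U_1(\sigma)=\partial\sigma\cup\{x\in V: x\sim z\text{ for some }z\in\partial\sigma\}$, where $x\sim z$ means $x,z$ are adjacent. *)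

theory Defs
  imports "HOL-Analysis.Analysis"
begin

text \<open>
  The plane is represented by the type \<^typ>\<open>complex\<close>. A plane graph is a pair \<open>(V, E)\<close> of a set
  of points and a set of closed edges, each edge being the image of an arc; the two endpoints of an
  edge \<open>e\<close> are the elements of \<open>e \<inter> V\<close>.
\<close>

definition adjacent :: "complex set \<Rightarrow> complex set set \<Rightarrow> complex \<Rightarrow> complex \<Rightarrow> bool" where
  "adjacent V E x y \<longleftrightarrow> x \<noteq> y \<and> (\<exists>e\<in>E. e \<inter> V = {x, y})"

definition vertex_degree :: "complex set set \<Rightarrow> complex \<Rightarrow> nat" where
  "vertex_degree E x = card {e \<in> E. x \<in> e}"

definition faces :: "complex set \<Rightarrow> complex set set \<Rightarrow> complex set set" where
  "faces V E = components (- (V \<union> \<Union>E))"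

definition boundary_edges :: "complex set set \<Rightarrow> complex set \<Rightarrow> complex set set" where
  "boundary_edges E \<sigma> = {e \<in> E. e \<subseteq> closure \<sigma>}"

definition face_degree :: "complex set set \<Rightarrow> complex set \<Rightarrow> nat" where
  "face_degree E \<sigma> = card (boundary_edges E \<sigma>)"

text \<open>
  Simplicity: there are no loops because the endpoints of an arc are distinct, and no multiple edges
  by \<open>edge_unique\<close>. Local finiteness is that of the embedding; it implies that every vertex has
  finite degree.
\<close>

locale plane_graph =
  fixes V :: "complex set" and E :: "complex set set"
  assumes edge_arc:
      "e \<in> E \<Longrightarrow> \<exists>g. arc g \<and> path_image g = e \<and> e \<inter> V = {pathstart g, pathfinish g}"
    and edge_inter: "e \<in> E \<Longrightarrow> e' \<in> E \<Longrightarrow> e \<noteq> e' \<Longrightarrow> e \<inter> e' \<subseteq> V"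
    and edge_unique: "e \<in> E \<Longrightarrow> e' \<in> E \<Longrightarrow> e \<inter> V = e' \<inter> V \<Longrightarrow> e = e'"
    and locally_finite: "\<exists>r>0. finite {e \<in> E. e \<inter> ball p r \<noteq> {}}"
    and connected_graph: "x \<in> V \<Longrightarrow> y \<in> V \<Longrightarrow> (adjacent V E)\<^sup>*\<^sup>* x y"

locale infinite_planar_tessellation = plane_graph +
  assumes face_disk: "\<sigma> \<in> faces V E \<Longrightarrow> closure \<sigma> homeomorphic cball (0::complex) 1"
    and face_bounded_by_edges: "\<sigma> \<in> faces V E \<Longrightarrow>
      finite (boundary_edges E \<sigma>) \<and> frontier (closure \<sigma>) = \<Union>(boundary_edges E \<sigma>)"
    and edge_two_faces: "e \<in> E \<Longrightarrow> card {\<sigma> \<in> faces V E. e \<subseteq> closure \<sigma>} = 2"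
    and face_inter: "\<sigma> \<in> faces V E \<Longrightarrow> \<tau> \<in> faces V E \<Longrightarrow> \<sigma> \<noteq> \<tau> \<Longrightarrow>
      closure \<sigma> \<inter> closure \<tau> = {} \<or> (\<exists>x\<in>V. closure \<sigma> \<inter> closure \<tau> = {x}) \<or>
      (\<exists>e\<in>E. closure \<sigma> \<inter> closure \<tau> = e)"
    and vertex_degree_ge_3: "x \<in> V \<Longrightarrow> vertex_degree E x \<ge> 3"
    and face_degree_ge_3: "\<sigma> \<in> faces V E \<Longrightarrow> face_degree E \<sigma> \<ge> 3"

definition curvature :: "complex set \<Rightarrow> complex set set \<Rightarrow> complex \<Rightarrow> real" where
  "curvature V E x = 1 - real (vertex_degree E x) / 2 +
     (\<Sum>\<sigma> \<in> {\<sigma> \<in> faces V E. x \<in> closure \<sigma>}. 1 / real (face_degree E \<sigma>))"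

definition face_vertices :: "complex set \<Rightarrow> complex set \<Rightarrow> complex set" where
  "face_vertices V \<sigma> = V \<inter> closure \<sigma>"

definition neighborhood1 :: "complex set \<Rightarrow> complex set set \<Rightarrow> complex set \<Rightarrow> complex set" where
  "neighborhood1 V E \<sigma> =
     face_vertices V \<sigma> \<union> {x \<in> V. \<exists>z \<in> face_vertices V \<sigma>. adjacent V E x z}"

end

theory Submission imports Defs begin

text \<open>
  At a vertex of a face \<open>s\<close> of degree at least 8, non-negative curvature leaves only triangles and
  at most one square as the other three faces. So two such faces \<open>s\<close>, \<open>t\<close> share no vertex, and the
  surroundings of each are so rigid that any contact between their 1-neighbourhoods propagates:
  consider the vertices of \<open>s\<close> and \<open>t\<close> that meet the strip between the two faces, together with the
  strip itself, which consists of the adjacent or coinciding pairs formed by the tip of a triangle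
  resting on an edge of \<open>s\<close> and the tip of a triangle resting on an edge of \<open>t\<close>. This finite set is
  closed under adjacency, so by connectedness it would be all of \<open>V\<close>. But a finite plane graph has
  an unbounded face, whose closure is not a disk.

  The cyclic order of edges and faces around a vertex needs no orientation: a face has exactly two
  boundary edges at each of its vertices, an edge lies on two faces, and two faces share at most one
  edge, so around a vertex of degree 4 the incidences form a 4-cycle.
\<close>

section \<open>Arcs ending at a point of a circle\<close>

lemma open_segment_subset_connected:
  fixes C :: "real set"
  assumes "connected C" "r \<in> closure C" "c \<in> C"
  shows "open_segment r c \<subseteq> C"
proof
  fix p assume p: "p \<in> open_segment r c"
  then have "\<bar>p - r\<bar> > 0" by (auto simp: open_segment_def)
  then obtain d where d: "d \<in> C" "\<bar>d - r\<bar> < \<bar>p - r\<bar>"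
    using \<open>r \<in> closure C\<close> unfolding closure_approachable dist_real_def by blast
  then have "p \<in> closed_segment d c"
    using p by (auto simp: open_segment_eq_real_ivl closed_segment_eq_real_ivl split: if_splits)
  moreover have "convex C" using \<open>connected C\<close> by (simp add: connected_convex_1)
  ultimately show "p \<in> C" using closed_segment_subset[OF d(1) \<open>c \<in> C\<close>] by blast
qed

lemma card_intervals_ending_at:
  fixes r :: real
  assumes conn: "\<And>C. C \<in> \<C> \<Longrightarrow> connected C"
    and ends: "\<And>C. C \<in> \<C> \<Longrightarrow> r \<in> closure C - C"
    and disj: "disjoint \<C>"
    and nbhd: "r \<in> interior (insert r (\<Union>\<C>))"
  shows "card \<C> = 2"
proof -
  obtain \<epsilon> where "\<epsilon> > 0" and ball: "ball r \<epsilon> \<subseteq> insert r (\<Union>\<C>)"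
    using nbhd by (auto simp: mem_interior)
  define u v where "u = r - \<epsilon> / 2" and "v = r + \<epsilon> / 2"
  have uv: "u < r" "r < v" "u \<in> ball r \<epsilon>" "v \<in> ball r \<epsilon>"
    using \<open>\<epsilon> > 0\<close> by (auto simp: u_def v_def dist_real_def)
  obtain L where L: "L \<in> \<C>" "u \<in> L" using ball uv by blast
  obtain R where R: "R \<in> \<C>" "v \<in> R" using ball uv by blast
  have germ: "open_segment r c \<subseteq> C" if "C \<in> \<C>" "c \<in> C" for C c
    using open_segment_subset_connected[of C r c] conn ends that by blast
  have "L \<noteq> R"
    using connectedD_interval[OF conn[OF L(1)] L(2), of v r] ends L R uv by auto
  moreover have "C = L \<or> C = R" if C: "C \<in> \<C>" for C
  proof -
    obtain c where c: "c \<in> C" "c \<noteq> r" using ends[OF C] by (metis DiffE closure_empty ex_in_conv)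
    have meet: "C = D" if "D \<in> \<C>" "d \<in> D" "p \<in> open_segment r c" "p \<in> open_segment r d" for D d p
      using disjointD[OF disj C, of D] germ[OF C c(1)] germ[OF that(1,2)] that by blast
    show ?thesis
    proof (cases "c < r")
      case True
      then have "(max c u + r) / 2 \<in> open_segment r c \<inter> open_segment r u"
        using uv by (auto simp: open_segment_eq_real_ivl max_def)
      then show ?thesis using meet L by blast
    next
      case False
      then have "(min c v + r) / 2 \<in> open_segment r c \<inter> open_segment r v"
        using uv c by (auto simp: open_segment_eq_real_ivl min_def)
      then show ?thesis using meet R by blast
    qed
  qed
  ultimately have "\<C> = {L, R}" using L R by blast
  then show ?thesis using \<open>L \<noteq> R\<close> by simp
qed

lemma continuous_on_image_in_closure:
  assumes "continuous_on S f" "C \<subseteq> S" "x \<in> S" "x \<in> closure C"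
  shows "f x \<in> closure (f ` C)"
proof -
  have "x \<in> top_of_set S closure_of C"
    using assms by (simp add: closure_of_subtopology Int_absorb1)
  then show ?thesis
    using continuous_map_image_closure_subset[of "top_of_set S" euclidean f C] assms(1) by auto
qed

lemma card_arcs_ending_at_line_point:
  fixes F :: "'a::topological_space set"
  assumes F: "F homeomorphic (UNIV :: real set)" and x: "x \<in> F"
    and arcs: "\<And>C. C \<in> \<C> \<Longrightarrow> connected C \<and> x \<in> closure C \<and> C \<subseteq> F - {x}"
    and disj: "disjoint \<C>"
    and nbhd: "x \<notin> closure (F - insert x (\<Union>\<C>))"
  shows "card \<C> = 2"
proof -
  obtain h k where "homeomorphism F (UNIV :: real set) h k"
    using F unfolding homeomorphic_def by blast
  then have h: "continuous_on F h" and inj: "inj_on h F" and k: "continuous_on UNIV k"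
    and k_h: "\<And>p. p \<in> F \<Longrightarrow> k (h p) = p" and h_k: "\<And>r. h (k r) = r" and k_in: "\<And>r. k r \<in> F"
    by (auto simp: homeomorphism_def intro: inj_on_inverseI)
  have sub: "C \<subseteq> F" if "C \<in> \<C>" for C using arcs[OF that] by blast
  have inj_Union: "inj_on h (\<Union>\<C>)" by (rule inj_on_subset[OF inj Union_least[OF sub]])
  have "card (image h ` \<C>) = 2"
  proof (rule card_intervals_ending_at)
    fix D assume "D \<in> image h ` \<C>"
    then obtain C where C: "C \<in> \<C>" "D = h ` C" by blast
    show "connected D"
      using arcs[OF C(1)] continuous_on_subset[OF h sub[OF C(1)]] C(2)
      by (simp add: connected_continuous_image)
    show "h x \<in> closure D - D"
      using continuous_on_image_in_closure[OF h sub[OF C(1)] x] arcs[OF C(1)] C(2)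
        inj_on_image_mem_iff[OF inj x sub[OF C(1)]] by blast
  next
    show "disjoint (image h ` \<C>)" by (rule disjoint_image[OF inj_Union disj])
    have "- insert (h x) (\<Union>(image h ` \<C>)) \<subseteq> k -` closure (F - insert x (\<Union>\<C>))"
    proof
      fix r assume "r \<in> - insert (h x) (\<Union>(image h ` \<C>))"
      then have "h (k r) \<notin> insert (h x) (h ` \<Union>\<C>)" by (simp add: h_k image_Union)
      then have "k r \<in> F - insert x (\<Union>\<C>)" using k_in[of r] by blast
      then show "r \<in> k -` closure (F - insert x (\<Union>\<C>))"
        using closure_subset[of "F - insert x (\<Union>\<C>)"] by (simp add: subsetD)
    qed
    then have "closure (- insert (h x) (\<Union>(image h ` \<C>))) \<subseteq> k -` closure (F - insert x (\<Union>\<C>))"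
      by (rule closure_minimal[OF _ closed_vimage[OF closed_closure k]])
    then show "h x \<in> interior (insert (h x) (\<Union>(image h ` \<C>)))"
      using nbhd k_h[OF x] by (auto simp: interior_closure)
  qed
  then show ?thesis
    using card_image[OF inj_on_image[OF inj_Union]] by simp
qed

lemma punctured_circle_homeomorphic_line:
  fixes F :: "'a::topological_space set"
  assumes F: "F homeomorphic sphere (0 :: complex) 1" and a: "a \<in> F"
  shows "(F - {a}) homeomorphic (UNIV :: real set)"
proof -
  obtain f g where fg: "homeomorphism F (sphere (0::complex) 1) f g"
    using F unfolding homeomorphic_def by blast
  have image: "f ` (F - {a}) = sphere 0 1 - {f a}"
    using fg a inj_on_image_set_diff[of f F F "{a}"] unfolding homeomorphism_def inj_on_def by auto
  have "homeomorphism (F - {a}) (sphere 0 1 - {f a}) f g"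
    using homeomorphism_of_subsets[OF fg _ _ image] by auto
  then have "F - {a} homeomorphic sphere 0 1 - {f a}"
    unfolding homeomorphic_def by blast
  also have "f a \<in> sphere 0 1" using fg a unfolding homeomorphism_def by blast
  then have "sphere 0 1 - {f a} homeomorphic (UNIV :: real set)"
    by (intro homeomorphic_punctured_sphere_affine) auto
  finally show ?thesis .
qed

lemma card_arcs_ending_at_circle_point:
  fixes F :: "'a::topological_space set"
  assumes F: "F homeomorphic sphere (0 :: complex) 1" and a: "a \<in> F" and x: "x \<in> F" "x \<noteq> a"
    and arcs: "\<And>C. C \<in> \<C> \<Longrightarrow> connected C \<and> x \<in> closure C \<and> C \<subseteq> F - {a, x}"
    and disj: "disjoint \<C>"
    and nbhd: "x \<notin> closure (F - insert x (\<Union>\<C>))"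
  shows "card \<C> = 2"
proof (rule card_arcs_ending_at_line_point[OF punctured_circle_homeomorphic_line[OF F a]])
  show "x \<in> F - {a}" using x by simp
  show "connected C \<and> x \<in> closure C \<and> C \<subseteq> F - {a} - {x}" if "C \<in> \<C>" for C
    using arcs[OF that] by blast
  show "disjoint \<C>" by (rule disj)
  have "closure (F - {a} - insert x (\<Union>\<C>)) \<subseteq> closure (F - insert x (\<Union>\<C>))"
    by (intro closure_mono) blast
  then show "x \<notin> closure (F - {a} - insert x (\<Union>\<C>))" using nbhd by blast
qed

section \<open>Four-regular maps\<close>

lemma card_eq_if_biregular:
  assumes "finite S" "finite T" "k > 0"
    and "\<And>i. i \<in> S \<Longrightarrow> card {j \<in> T. R i j} = k" and "\<And>j. j \<in> T \<Longrightarrow> card {i \<in> S. R i j} = k"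
  shows "card S = card T"
proof -
  have "(\<Sum>i\<in>S. card {j \<in> T. R i j}) = k * card T"
    using assms by (intro sum_multicount) auto
  then show ?thesis using assms by simp
qed

lemma card_2_other:
  assumes "card S = 2" "a \<in> S"
  obtains b where "b \<in> S" "b \<noteq> a"
  using assms unfolding card_2_iff' by metis

lemma eq_doubleton_if_card_2:
  assumes "card S = 2" "a \<in> S" "b \<in> S" "a \<noteq> b"
  shows "S = {a, b}"
  using assms unfolding card_2_iff by auto

text \<open>\<open>inc f x y\<close> stands for: the edge \<open>xy\<close> lies on the boundary of the face \<open>f\<close>.\<close>

locale face_incidence =
  fixes inc :: "'f \<Rightarrow> 'v \<Rightarrow> 'v \<Rightarrow> bool"
  assumes inc_sym: "inc f x y \<Longrightarrow> inc f y x"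
    and inc_irrefl: "\<not> inc f x x"
begin

definition adj :: "'v \<Rightarrow> 'v \<Rightarrow> bool" where "adj x y \<longleftrightarrow> (\<exists>f. inc f x y)"

definition on :: "'f \<Rightarrow> 'v \<Rightarrow> bool" where "on f x \<longleftrightarrow> (\<exists>y. inc f x y)"

definition verts :: "'v set" where "verts = {x. \<exists>f. on f x}"

definition near :: "'f \<Rightarrow> 'v \<Rightarrow> bool" where "near f x \<longleftrightarrow> on f x \<or> (\<exists>z. on f z \<and> adj x z)"

definition deg :: "'f \<Rightarrow> nat" where "deg f = card {x. on f x}"

lemma inc_neq: "inc f x y \<Longrightarrow> x \<noteq> y"
  using inc_irrefl by blast

lemma adj_sym: "adj x y \<Longrightarrow> adj y x"
  by (auto simp: adj_def intro: inc_sym)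

lemma adjI: "inc f x y \<Longrightarrow> adj x y"
  by (auto simp: adj_def)

lemma onI: "inc f x y \<Longrightarrow> on f x" "inc f x y \<Longrightarrow> on f y"
  by (auto simp: on_def intro: inc_sym)

lemma near_in_verts: "near f x \<Longrightarrow> x \<in> verts"
  unfolding near_def adj_def verts_def using onI by blast

end

locale four_regular_map = face_incidence inc
  for inc :: "'f \<Rightarrow> 'v \<Rightarrow> 'v \<Rightarrow> bool" +
  assumes two_neighbours_on_face: "on f x \<Longrightarrow> card {y. inc f x y} = 2"
    and two_faces_at_edge: "inc f x y \<Longrightarrow> card {g. inc g x y} = 2"
    and four_neighbours: "adj x y \<Longrightarrow> card {z. adj x z} = 4"
    and common_edge: "\<lbrakk>f \<noteq> g; x \<noteq> y; on f x; on g x; on f y; on g y\<rbrakk> \<Longrightarrow> inc f x y"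
    and common_vertices: "\<lbrakk>f \<noteq> g; x \<noteq> y; on f x; on g x; on f y; on g y; on f z; on g z\<rbrakk>
      \<Longrightarrow> z = x \<or> z = y"
begin

lemma other_on_face:
  assumes "inc f x y" obtains z where "inc f x z" "z \<noteq> y"
  using card_2_other[OF two_neighbours_on_face] onI(1)[OF assms] assms by blast

lemma other_face:
  assumes "inc f x y" obtains g where "inc g x y" "g \<noteq> f"
  using card_2_other[OF two_faces_at_edge[OF assms]] assms by blast

lemma neighbours_on_face: "\<lbrakk>inc f x y; inc f x z; y \<noteq> z; inc f x w\<rbrakk> \<Longrightarrow> w = y \<or> w = z"
  using eq_doubleton_if_card_2[OF two_neighbours_on_face] onI(1) by blast

lemma faces_at_edge: "\<lbrakk>inc f x y; inc g x y; f \<noteq> g; inc h x y\<rbrakk> \<Longrightarrow> h = f \<or> h = g"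
  using eq_doubleton_if_card_2[OF two_faces_at_edge] by blast

lemma off_if_beyond_common_edge:
  assumes "inc f x y" "inc g x y" "f \<noteq> g" "on g z" "z \<noteq> x" "z \<noteq> y"
  shows "\<not> on f z"
  using common_vertices[OF assms(3) inc_neq[OF assms(1)]] onI[OF assms(1)] onI[OF assms(2)]
    assms(4-6) by blast

lemma face_eqI:
  assumes "inc f x y" "inc f x z" "inc g x y" "inc g x z" "y \<noteq> z"
  shows "f = g"
  using off_if_beyond_common_edge[OF assms(1,3) _ onI(2)[OF assms(4)]] onI(2)[OF assms(2)]
    inc_neq[OF assms(4)] assms(5) by blast

lemma neighbours_eq:
  assumes "adj x a" "adj x b" "adj x c" "adj x d" "distinct [a, b, c, d]"
  shows "{v. adj x v} = {a, b, c, d}"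
proof (rule card_subset_eq[symmetric])
  show "finite {v. adj x v}"
    using four_neighbours[OF assms(1)] by (simp add: card_ge_0_finite)
  show "card {a, b, c, d} = card {v. adj x v}"
    using four_neighbours[OF assms(1)] assms(5) by simp
qed (use assms in blast)

lemma card_faces_at:
  assumes "on f x" shows "card {g. on g x} = 4"
proof -
  obtain y where "adj x y" using assms adjI unfolding on_def by blast
  then have four: "card {z. adj x z} = 4" by (rule four_neighbours)
  then have fin: "finite {z. adj x z}" by (simp add: card_ge_0_finite)
  have two: "card {g. inc g x z} = 2" if "adj x z" for z
    using that two_faces_at_edge unfolding adj_def by blast
  have "{g. on g x} = (\<Union>z\<in>{z. adj x z}. {g. inc g x z})"
    by (auto simp: on_def adj_def)
  moreover have "finite {g. inc g x z}" if "adj x z" for z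
    using two[OF that] by (simp add: card_ge_0_finite)
  ultimately have fin': "finite {g. on g x}" using fin by simp
  have "card {z. adj x z} = card {g. on g x}"
  proof (rule card_eq_if_biregular[OF fin fin', where k = 2])
    fix z assume "z \<in> {z. adj x z}"
    moreover have "{g \<in> {g. on g x}. inc g x z} = {g. inc g x z}" by (auto simp: on_def)
    ultimately show "card {g \<in> {g. on g x}. inc g x z} = 2" using two by simp
  next
    fix g assume "g \<in> {g. on g x}"
    moreover have "{z \<in> {z. adj x z}. inc g x z} = {z. inc g x z}" by (auto simp: adj_def)
    ultimately show "card {z \<in> {z. adj x z}. inc g x z} = 2" using two_neighbours_on_face by simp
  qed simp
  then show ?thesis using four by simp
qed

lemma fourth_face:
  assumes "on f x" "on g x" "on h x" "distinct [f, g, h]"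
  obtains k where "k \<notin> {f, g, h}" "{l. on l x} = {f, g, h, k}"
proof -
  have four: "card {l. on l x} = 4" using card_faces_at[OF assms(1)] .
  have sub: "{f, g, h} \<subseteq> {l. on l x}" using assms by simp
  then have "card ({l. on l x} - {f, g, h}) = 1"
    using four assms(4) by (simp add: card_Diff_subset)
  then obtain k where "{l. on l x} - {f, g, h} = {k}" by (auto simp: card_1_singleton_iff)
  then show thesis using that[of k] sub by blast
qed

text \<open>The neighbours \<open>p, a, b, q\<close> of \<open>x\<close> in cyclic order, with the faces in the corners between.\<close>

definition rotation :: "'v \<Rightarrow> 'f \<Rightarrow> 'v \<Rightarrow> 'f \<Rightarrow> 'v \<Rightarrow> 'f \<Rightarrow> 'v \<Rightarrow> 'f \<Rightarrow> 'v \<Rightarrow> bool" where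
  "rotation x f p A a B b C q \<longleftrightarrow> distinct [p, a, b, q] \<and> distinct [f, A, B, C] \<and>
     inc f x q \<and> inc f x p \<and> inc A x p \<and> inc A x a \<and> inc B x a \<and> inc B x b \<and> inc C x b \<and> inc C x q"

lemma rotation_reverse: "rotation x f p A a B b C q \<Longrightarrow> rotation x f q C b B a A p"
  unfolding rotation_def by auto

lemma rotation_neighbours:
  assumes "rotation x f p A a B b C q"
  shows "{v. adj x v} = {p, a, b, q}"
  using assms unfolding rotation_def by (intro neighbours_eq) (auto intro: adjI)

lemma rotation_faces:
  assumes "rotation x f p A a B b C q"
  shows "{g. on g x} = {f, A, B, C}"
proof (rule card_subset_eq[symmetric])
  have "on f x" and dist: "distinct [f, A, B, C]"
    using assms onI(1) unfolding rotation_def by blast+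
  then have four: "card {g. on g x} = 4" using card_faces_at by blast
  then show "finite {g. on g x}" by (simp add: card_ge_0_finite)
  show "card {f, A, B, C} = card {g. on g x}" using four dist by simp
  show "{f, A, B, C} \<subseteq> {g. on g x}" using assms onI(1) unfolding rotation_def by blast
qed

lemma neighbour_on_one_of_three_faces:
  assumes "on f x" "on g x" "on h x" "distinct [f, g, h]" "adj x v"
  shows "inc f x v \<or> inc g x v \<or> inc h x v"
proof -
  obtain k where faces: "{l. on l x} = {f, g, h, k}" using fourth_face[OF assms(1-4)] .
  obtain l where l: "inc l x v" using assms(5) unfolding adj_def by blast
  obtain m where m: "inc m x v" "m \<noteq> l" using other_face[OF l] .
  have "l \<in> {f, g, h, k}" "m \<in> {f, g, h, k}" using onI(1)[OF l] onI(1)[OF m(1)] faces by blast+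
  then show ?thesis using l m by blast
qed

lemma rotation_exists:
  assumes p: "inc f x p"
  obtains A a B b C q where "rotation x f p A a B b C q"
proof -
  obtain q where q: "inc f x q" "q \<noteq> p" using other_on_face[OF p] .
  obtain A where A: "inc A x p" "A \<noteq> f" using other_face[OF p] .
  obtain C where C: "inc C x q" "C \<noteq> f" using other_face[OF q(1)] .
  obtain a where a: "inc A x a" "a \<noteq> p" using other_on_face[OF A(1)] .
  obtain b where b: "inc C x b" "b \<noteq> q" using other_on_face[OF C(1)] .
  have "a \<noteq> q" using face_eqI[OF p q(1) A(1)] A(2) a q by auto
  have "b \<noteq> p" using face_eqI[OF p q(1), of C] C b q by auto
  have "A \<noteq> C" using neighbours_on_face[OF A(1) a(1), of q] C \<open>a \<noteq> q\<close> a q by auto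
  have on_f: "v \<in> {p, q}" if "inc f x v" for v
    using neighbours_on_face[OF p q(1) q(2)[symmetric] that] by blast
  have on_A: "v \<in> {p, a}" if "inc A x v" for v
    using neighbours_on_face[OF A(1) a(1) a(2)[symmetric] that] by blast
  have on_C: "v \<in> {q, b}" if "inc C x v" for v
    using neighbours_on_face[OF C(1) b(1) b(2)[symmetric] that] by blast
  have on: "on f x" "on A x" "on C x" and dist: "distinct [f, A, C]"
    using onI(1) p a(1) b(1) A(2) C(2) \<open>A \<noteq> C\<close> by auto
  have "a \<noteq> b"
  proof
    assume "a = b"
    then have "{v. adj x v} \<subseteq> {p, q, a}"
      using neighbour_on_one_of_three_faces[OF on dist] on_f on_A on_C by blast
    then have "card {v. adj x v} \<le> card {p, q, a}" by (intro card_mono) auto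
    also have "\<dots> \<le> 3" by (simp add: card_insert_if)
    finally show False using four_neighbours[OF adjI[OF p]] by simp
  qed
  obtain B where B: "B \<notin> {f, A, C}" and faces: "{g. on g x} = {f, A, C, B}"
    using fourth_face[OF on dist] .
  have "inc B x v" if "inc g x v" "g \<notin> {f, A, C}" for g v
    using faces onI(1)[OF that(1)] that by auto
  moreover obtain g where "inc g x a" "g \<noteq> A" using other_face[OF a(1)] .
  moreover obtain h where "inc h x b" "h \<noteq> C" using other_face[OF b(1)] .
  ultimately have "inc B x a" "inc B x b"
    using on_f[of a] on_C[of a] on_f[of b] on_A[of b] a(2) b(2) \<open>a \<noteq> q\<close> \<open>b \<noteq> p\<close> \<open>a \<noteq> b\<close> by blast+
  moreover have "distinct [f, A, B, C]" using B A(2) C(2) \<open>A \<noteq> C\<close> by auto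
  ultimately have "rotation x f p A a B b C q"
    using p q A a b C \<open>a \<noteq> q\<close> \<open>b \<noteq> p\<close> \<open>a \<noteq> b\<close> unfolding rotation_def by auto
  then show thesis by (rule that)
qed

lemma rotation_off:
  assumes "rotation x f p A a B b C q"
  shows "\<not> on f a" "\<not> on f b"
proof -
  have off: "\<not> on f a" if "rotation x f p A a B b C q" for p A a B b C q
    using off_if_beyond_common_edge[of f x p A a] onI(2)[of A x a] inc_neq[of A x a] that
    unfolding rotation_def by auto
  show "\<not> on f a" "\<not> on f b" using off assms rotation_reverse by blast+
qed

lemma rotation_from_face:
  assumes "on f x" "adj x a" "\<not> on f a"
  obtains p A B b C q where "rotation x f p A a B b C q"
proof -
  obtain p where "inc f x p" using assms(1) unfolding on_def by blast
  then obtain q A a' B b' C where rot: "rotation x f p A a' B b' C q" by (rule rotation_exists)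
  have "a \<in> {p, a', b', q}" using rotation_neighbours[OF rot] assms(2) by blast
  then have "a = a' \<or> a = b'" using rot assms(3) onI(2) unfolding rotation_def by blast
  then show thesis using that rot rotation_reverse by blast
qed

lemma triangle_edge:
  assumes deg: "deg f = 3" and xy: "inc f x y" and xz: "inc f x z" and "y \<noteq> z"
  shows "inc f y z"
proof -
  have "{x, y, z} = {v. on f v}"
  proof (rule card_subset_eq)
    show "finite {v. on f v}" using deg unfolding deg_def by (simp add: card_ge_0_finite)
    show "{x, y, z} \<subseteq> {v. on f v}" using xy xz onI by blast
    show "card {x, y, z} = card {v. on f v}"
      using deg inc_neq[OF xy] inc_neq[OF xz] \<open>y \<noteq> z\<close> unfolding deg_def by simp
  qed
  moreover obtain w where w: "inc f y w" "w \<noteq> x" using other_on_face[OF inc_sym[OF xy]] .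
  ultimately have "w = z" using onI(2)[OF w(1)] inc_neq[OF w(1)] by blast
  then show ?thesis using w(1) by simp
qed

lemma square_corner:
  assumes deg: "deg f = 4" and xy: "inc f x y" and xz: "inc f x z" and "y \<noteq> z"
  obtains w where "w \<notin> {x, y, z}" "inc f y w" "inc f z w"
proof -
  have fin: "finite {v. on f v}" using deg unfolding deg_def by (simp add: card_ge_0_finite)
  have sub: "{x, y, z} \<subseteq> {v. on f v}" using xy xz onI by blast
  have "card ({v. on f v} - {x, y, z}) = 1"
    using deg sub inc_neq[OF xy] inc_neq[OF xz] \<open>y \<noteq> z\<close> unfolding deg_def
    by (simp add: card_Diff_subset)
  then obtain w where "{v. on f v} - {x, y, z} = {w}" by (auto simp: card_1_singleton_iff)
  then have w: "w \<notin> {x, y, z}" "on f w" and only: "\<And>v. on f v \<Longrightarrow> v \<in> {x, y, z, w}" by blast+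
  have "\<not> inc f y z"
  proof
    assume yz: "inc f y z"
    obtain u where u: "inc f w u" using w(2) unfolding on_def by blast
    then have "inc f u w" "u \<in> {x, y, z}" using inc_sym only onI(2) inc_neq by blast+
    then show False
      using neighbours_on_face[of f x y z w] neighbours_on_face[of f y x z w]
        neighbours_on_face[of f z x y w] xy xz yz inc_sym w(1) inc_neq \<open>y \<noteq> z\<close> by blast
  qed
  then have "\<not> inc f z y" using inc_sym by blast
  obtain u where "inc f y u" "u \<noteq> x" using other_on_face[OF inc_sym[OF xy]] .
  then have "inc f y w" using only onI(2) inc_neq \<open>\<not> inc f y z\<close> by blast
  obtain v where "inc f z v" "v \<noteq> x" using other_on_face[OF inc_sym[OF xz]] .
  then have "inc f z w" using only onI(2) inc_neq \<open>\<not> inc f z y\<close> by blast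
  show thesis by (rule that) fact+
qed

end

section \<open>Large faces\<close>

lemma reciprocal_sum_with_large_term:
  fixes k a b c :: nat
  assumes "k \<ge> 8" "a \<ge> 3" "b \<ge> 3" "c \<ge> 3" and sum: "1 / k + 1 / a + 1 / b + 1 / c \<ge> (1 :: real)"
  shows "(a, b, c) \<in> {(3, 3, 3), (4, 3, 3), (3, 4, 3), (3, 3, 4)}"
proof -
  have reciprocal_le: "1 / real n \<le> 1 / m" if "m \<le> real n" "m > 0" for m :: real and n :: nat
    using that by (simp add: frac_le)
  have bounds: "1 / real k \<le> 1 / 8" "1 / real a \<le> 1 / 3" "1 / real b \<le> 1 / 3" "1 / real c \<le> 1 / 3"
    using assms by (auto intro!: reciprocal_le simp del: divide_le_eq_1 le_divide_eq_numeral1)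
  have "real a < 5" "real b < 5" "real c < 5"
    using reciprocal_le[of 5 a] reciprocal_le[of 5 b] reciprocal_le[of 5 c] bounds sum by linarith+
  then have "a = 3 \<or> a = 4" "b = 3 \<or> b = 4" "c = 3 \<or> c = 4"
    using assms(2-4) by auto
  moreover have "\<not> (a = 4 \<and> b = 4)" "\<not> (a = 4 \<and> c = 4)" "\<not> (b = 4 \<and> c = 4)"
    using bounds sum by auto
  ultimately show ?thesis by auto
qed

locale nonneg_four_regular_map = four_regular_map inc
  for inc :: "'f \<Rightarrow> 'v \<Rightarrow> 'v \<Rightarrow> bool" +
  assumes finite_face: "finite {x. on f x}"
    and nonneg: "on f x \<Longrightarrow> (\<Sum>g | on g x. 1 / real (deg g)) \<ge> 1"
begin

lemma deg_ge_3:
  assumes "on f x" shows "deg f \<ge> 3"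
proof -
  obtain y where y: "inc f x y" using assms unfolding on_def by blast
  obtain z where z: "inc f x z" "z \<noteq> y" using other_on_face[OF y] .
  have "card {x, y, z} = 3" using y z inc_neq by (simp add: card_insert_if)
  moreover have "{x, y, z} \<subseteq> {v. on f v}" using y z onI by blast
  ultimately show ?thesis unfolding deg_def using card_mono[OF finite_face] by metis
qed

lemma finite_near: "finite {v. near f v}"
proof -
  have "finite {v. adj x v}" for x
  proof (cases "\<exists>a. adj x a")
    case True
    then show ?thesis using four_neighbours by (auto intro: card_ge_0_finite)
  qed simp
  then have "finite ({v. on f v} \<union> (\<Union>x\<in>{x. on f x}. {v. adj x v}))"
    using finite_face by blast
  moreover have "{v. near f v} \<subseteq> {v. on f v} \<union> (\<Union>x\<in>{x. on f x}. {v. adj x v})"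
    using adj_sym unfolding near_def by blast
  ultimately show ?thesis by (rule finite_subset[rotated])
qed

definition large :: "'f \<Rightarrow> bool" where "large s \<longleftrightarrow> deg s \<ge> 8"

lemma degrees_around_large:
  assumes "large s" and rot: "rotation x s p A a B b C q"
  shows "(deg A, deg B, deg C) \<in> {(3, 3, 3), (4, 3, 3), (3, 4, 3), (3, 3, 4)}"
proof (rule reciprocal_sum_with_large_term)
  have on: "on s x" "on A x" "on B x" "on C x" and dist: "distinct [s, A, B, C]"
    using rot onI(1) unfolding rotation_def by blast+
  show "deg A \<ge> 3" "deg B \<ge> 3" "deg C \<ge> 3" using on deg_ge_3 by blast+
  show "1 / deg s + 1 / deg A + 1 / deg B + 1 / deg C \<ge> (1 :: real)"
    using nonneg[OF on(1)] dist unfolding rotation_faces[OF rot] by simp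
qed (use assms in \<open>simp add: large_def\<close>)

lemma degree_beside_large:
  assumes "large s" "on s x" "on f x" "f \<noteq> s"
  shows "deg f = 3 \<or> deg f = 4"
proof -
  obtain p where "inc s x p" using assms(2) unfolding on_def by blast
  then obtain A a B b C q where rot: "rotation x s p A a B b C q" by (rule rotation_exists)
  have "f \<in> {A, B, C}" using rotation_faces[OF rot] assms(3,4) by blast
  then show ?thesis using degrees_around_large[OF assms(1) rot] by auto
qed

lemma large_faces_disjoint: "\<lbrakk>large s; large t; s \<noteq> t; on s x\<rbrakk> \<Longrightarrow> \<not> on t x"
  using degree_beside_large[of s x t] unfolding large_def by auto

definition tip :: "'f \<Rightarrow> 'v \<Rightarrow> bool" where
  "tip s y \<longleftrightarrow> (\<exists>f x x'. f \<noteq> s \<and> deg f = 3 \<and> inc s x x' \<and> inc f x x' \<and> inc f x y \<and> inc f x' y)"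

lemma tip_off:
  assumes "tip s y" shows "\<not> on s y"
proof -
  obtain f x x' where f: "f \<noteq> s" "inc s x x'" "inc f x x'" "inc f x y" "inc f x' y"
    using assms unfolding tip_def by blast
  show ?thesis
    using off_if_beyond_common_edge[OF f(2,3) f(1)[symmetric] onI(2)[OF f(4)]]
      inc_neq[OF f(4)] inc_neq[OF f(5)] by blast
qed

lemma tip_rotation:
  assumes "tip s y" "adj y w" "\<not> on s w"
  obtains T x A B b C x' where "rotation y T x A w B b C x'" "on s x" "on s x'"
proof -
  obtain T x x' where T: "T \<noteq> s" "inc s x x'" "inc T x x'" "inc T x y" "inc T x' y"
    using assms(1) unfolding tip_def by blast
  have on: "on s x" "on s x'" "x \<noteq> x'" using T(2) onI inc_neq by blast+
  obtain A a B b C q where rot: "rotation y T x A a B b C q"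
    using rotation_exists[OF inc_sym[OF T(4)]] .
  have "inc T y x" "inc T y q" "q \<noteq> x" using rot unfolding rotation_def by auto
  then have "x' = q" using neighbours_on_face[of T y x q x'] inc_sym[OF T(5)] on(3) by auto
  moreover have "w \<in> {x, a, b, q}" using rotation_neighbours[OF rot] assms(2) by blast
  then have "w = a \<or> w = b" using assms(3) on \<open>x' = q\<close> by blast
  ultimately show thesis using that rot rotation_reverse[OF rot] on by blast
qed

lemma tip_of_rotation:
  assumes "rotation x s p A a B b C q" "deg A = 3"
  shows "tip s a"
proof -
  have inc: "A \<noteq> s" "inc s x p" "inc A x p" "inc A x a" "p \<noteq> a"
    using assms(1) unfolding rotation_def by auto
  then have "inc A p a" using triangle_edge[OF assms(2)] by blast
  then show ?thesis using inc assms(2) unfolding tip_def by blast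
qed

definition attached :: "'f \<Rightarrow> 'v \<Rightarrow> bool" where
  "attached s y \<longleftrightarrow> (\<exists>x x'. x \<noteq> x' \<and> on s x \<and> on s x' \<and> adj y x \<and> adj y x')"

lemma attached_if_on:
  assumes "on s y" shows "attached s y"
proof -
  obtain x where x: "inc s y x" using assms unfolding on_def by blast
  obtain x' where "inc s y x'" "x' \<noteq> x" using other_on_face[OF x] .
  then show ?thesis using x onI(2) adjI unfolding attached_def by blast
qed

lemma attached_if_tip:
  assumes "tip s y" shows "attached s y"
proof -
  obtain f x x' where f: "inc s x x'" "inc f x y" "inc f x' y"
    using assms unfolding tip_def by blast
  then show ?thesis
    using onI[OF f(1)] inc_neq[OF f(1)] adj_sym[OF adjI[OF f(2)]] adj_sym[OF adjI[OF f(3)]]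
    unfolding attached_def by blast
qed

text \<open>The square \<open>k\<close> opposite \<open>s\<close> is the only one at \<open>x\<close>, so its two companions are triangles.\<close>

lemma tip_if_square_opposite:
  assumes large: "large s" and x: "on s x" and k: "inc k x a" "inc k x b" "a \<noteq> b"
    and off: "\<not> on s a" "\<not> on s b" and square: "deg k = 4"
  shows "tip s a"
proof -
  obtain p A B c C q where rot: "rotation x s p A a B c C q"
    using rotation_from_face[OF x adjI[OF k(1)] off(1)] .
  have "b \<in> {p, a, c, q}" using rotation_neighbours[OF rot] adjI[OF k(2)] by blast
  then have "b = c" using k(3) off(2) rot onI(2) unfolding rotation_def by blast
  then have "k = B" using face_eqI[OF k(1,2)] rot k(3) unfolding rotation_def by blast
  then have "deg A = 3" using degrees_around_large[OF large rot] square by auto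
  then show ?thesis using tip_of_rotation[OF rot] by blast
qed

lemma square_if_path_beside_large:
  assumes s: "large s" "on s x" "k \<noteq> s" and path: "inc k x y" "inc k y w" "inc k w z"
    and neq: "x \<noteq> w" "y \<noteq> z" "x \<noteq> z"
  shows "deg k = 4" "inc k x z"
proof -
  have neighbours_of_w: "v = y \<or> v = z" if "inc k w v" for v
    using neighbours_on_face[OF inc_sym[OF path(2)] path(3) neq(2) that] .
  have "deg k \<noteq> 3"
  proof
    assume "deg k = 3"
    then have "inc k w x"
      using triangle_edge[OF _ inc_sym[OF path(1)] path(2) neq(1)] inc_sym by blast
    then show False using neighbours_of_w[of x] inc_neq[OF path(1)] neq(3) by blast
  qed
  then show deg: "deg k = 4"
    using degree_beside_large[OF s(1,2) onI(1)[OF path(1)] s(3)] by blast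
  obtain v where v: "v \<notin> {y, x, w}" "inc k x v" "inc k w v"
    using square_corner[OF deg inc_sym[OF path(1)] path(2) neq(1)] .
  then show "inc k x z" using neighbours_of_w[of v] by blast
qed

text \<open>
  As \<open>y\<close> is not a tip, the face \<open>xyc\<close> next to \<open>s\<close> is a square; it uses up the only square allowed
  at \<open>x\<close>, so the last neighbour \<open>b\<close> of \<open>x\<close> is a tip.
\<close>

lemma neighbour_not_tip:
  assumes large: "large s" and x: "on s x" and y: "adj x y" "\<not> on s y" "\<not> tip s y"
  obtains b c u where "adj x b" "adj y b" "tip s b" "adj y c" "c \<noteq> b" "\<not> on s c" "on s u" "adj c u"
proof -
  obtain p A B b C q where rot: "rotation x s p A y B b C q"
    using rotation_from_face[OF x y(1,2)] .
  have degs: "deg A = 4" "deg B = 3" "deg C = 3"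
    using degrees_around_large[OF large rot] tip_of_rotation[OF rot] y(3) by auto
  have inc: "inc s x p" "inc A x p" "inc A x y" "inc B x y" "inc B x b"
    "p \<noteq> y" "y \<noteq> b" "A \<noteq> B" "A \<noteq> s"
    using rot unfolding rotation_def by auto
  obtain c where c: "c \<notin> {x, p, y}" "inc A p c" "inc A y c"
    using square_corner[OF degs(1) inc(2,3,6)] .
  have yb: "inc B y b" using triangle_edge[OF degs(2) inc(4,5,7)] .
  have "b \<noteq> c"
    using face_eqI[of A y x c B] inc_sym[OF inc(3)] inc_sym[OF inc(4)] c yb inc(8) by blast
  moreover have "\<not> on s c"
    using off_if_beyond_common_edge[OF inc(1,2) inc(9)[symmetric] onI(2)[OF c(2)]] c(1) by blast
  moreover have "tip s b" using tip_of_rotation[OF rotation_reverse[OF rot]] degs(3) by blast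
  ultimately show thesis
    using that[of b c p] adjI[OF inc(5)] adjI[OF yb] adjI[OF c(3)] onI(2)[OF inc(1)]
      adjI[OF inc_sym[OF c(2)]] by blast
qed

end

section \<open>The strip between two large faces\<close>

locale two_large_faces = nonneg_four_regular_map inc
  for inc :: "'f \<Rightarrow> 'v \<Rightarrow> 'v \<Rightarrow> bool" +
  fixes s t :: 'f
  assumes large_s: "large s" and large_t: "large t" and faces_neq: "s \<noteq> t"
begin

text \<open>
  The pairs \<open>y \<noteq> w\<close> cover a zigzag of squares between \<open>s\<close> and \<open>t\<close>, whose vertices are adjacent to
  only one of the two faces.
\<close>

definition linked :: "'v \<Rightarrow> 'v \<Rightarrow> bool" where
  "linked y w \<longleftrightarrow> tip s y \<and> tip t w \<and> \<not> on t y \<and> \<not> on s w \<and> (y = w \<or> adj y w)"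

definition mid :: "'v \<Rightarrow> bool" where
  "mid y \<longleftrightarrow> (\<exists>w. linked y w \<or> linked w y)"

definition across :: "'v \<Rightarrow> bool" where
  "across y \<longleftrightarrow> on t y \<or> mid y"

definition rim :: "'v \<Rightarrow> bool" where
  "rim x \<longleftrightarrow> on s x \<and> (\<exists>y. adj x y \<and> across y)"

lemma no_common_vertex: "\<not> (on s x \<and> on t x)"
  using large_faces_disjoint large_s large_t faces_neq by blast

lemma neighbour_of_doubly_attached:
  assumes "attached s y" "attached t y" "adj y v"
  shows "on s v \<or> on t v"
proof -
  obtain x x' where x: "x \<noteq> x'" "on s x" "on s x'" "adj y x" "adj y x'"
    using assms(1) unfolding attached_def by blast
  obtain z z' where z: "z \<noteq> z'" "on t z" "on t z'" "adj y z" "adj y z'"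
    using assms(2) unfolding attached_def by blast
  have "distinct [x, x', z, z']" using x z no_common_vertex by auto
  then have "{v. adj y v} = {x, x', z, z'}" using neighbours_eq x z by blast
  then have "v \<in> {x, x', z, z'}" using assms(3) by blast
  then show ?thesis using x z by blast
qed

lemma tip_beside_off_vertex:
  assumes "tip s y" "adj y v" "\<not> on s v" "\<not> on t v"
  shows "\<not> on t y" "\<not> tip t y"
  using neighbour_of_doubly_attached[of y v] attached_if_tip attached_if_on assms by blast+

lemma mid_off:
  assumes "mid y" shows "\<not> on s y" "\<not> on t y"
  using assms tip_off unfolding mid_def linked_def by blast+

lemma across_off: "across y \<Longrightarrow> \<not> on s y"
  using mid_off no_common_vertex unfolding across_def by blast

lemma no_crossing_path:
  assumes "on s x" "\<not> on s y" "\<not> on s w" "\<not> on t w" "on t z"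
    and k: "inc k x y" "inc k y w" "inc k w z" "y \<noteq> z"
  shows False
proof -
  have "k \<noteq> s" using onI[OF k(1)] assms(2) by blast
  have neq: "x \<noteq> w" "x \<noteq> z" "\<not> on s z" using assms no_common_vertex by blast+
  have deg: "deg k = 4" and xz: "inc k x z"
    using square_if_path_beside_large[OF large_s assms(1) \<open>k \<noteq> s\<close> k(1-3) neq(1) k(4) neq(2)] .
  have "tip s z"
    using tip_if_square_opposite[OF large_s assms(1) xz k(1) k(4)[symmetric] neq(3) assms(2) deg] .
  then show False
    using tip_beside_off_vertex(1)[of z w] adjI[OF inc_sym[OF k(3)]] assms(3-5) by blast
qed

lemma tip_across_square:
  assumes "on t z" "\<not> on t w" "\<not> on t a" and h: "inc h z w" "inc h w y" "inc h y a" "y \<noteq> z" "a \<noteq> w"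
  shows "tip t a"
proof -
  have "h \<noteq> t" using onI[OF h(1)] assms(2) by blast
  have "z \<noteq> a" using assms(1,3) by blast
  have deg: "deg h = 4" and za: "inc h z a"
    using square_if_path_beside_large[OF large_t assms(1) \<open>h \<noteq> t\<close> h(1-3) h(4,5)[symmetric]]
      \<open>z \<noteq> a\<close> by blast+
  show ?thesis
    using tip_if_square_opposite[OF large_t assms(1) za h(1,5) assms(3,2) deg] .
qed

lemma tip_if_neighbour_linked:
  assumes "linked y w" "adj y v" "\<not> on s v" "\<not> on t v"
  shows "tip t v"
proof (cases "v = w")
  case False
  have y: "tip s y" "\<not> on s y" "\<not> on t y" and w: "tip t w" "\<not> on s w" "\<not> on t w"
    using assms(1) tip_off unfolding linked_def by blast+
  have "adj y w"
    using assms(1) tip_beside_off_vertex(2)[OF y(1) assms(2-4)] unfolding linked_def by blast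
  then obtain T x A B b C x' where rot: "rotation y T x A w B b C x'" and x: "on s x" "on s x'"
    using tip_rotation[OF y(1) _ w(2)] by blast
  have "v \<in> {x, w, b, x'}" using rotation_neighbours[OF rot] assms(2) by blast
  then have "v = b" using assms(3) x False by blast
  then have A: "inc A x y" "inc A y w" and B: "inc B w y" "inc B y v" and "A \<noteq> B"
    using rot inc_sym unfolding rotation_def by auto
  obtain T' z G where z: "on t z" "inc G w z" "inc G w y"
    using tip_rotation[OF w(1) adj_sym[OF \<open>adj y w\<close>] y(3)] unfolding rotation_def by metis
  have "z \<noteq> y" using z(1) y(3) by blast
  have "G = A \<or> G = B" using faces_at_edge[OF inc_sym[OF A(2)] B(1) \<open>A \<noteq> B\<close> z(3)] .
  then show ?thesis
  proof
    assume "G = A"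
    then show ?thesis
      using no_crossing_path[OF x(1) y(2) w(2,3) z(1) A] z(2) \<open>z \<noteq> y\<close> by blast
  next
    assume "G = B"
    then show ?thesis
      using tip_across_square[OF z(1) w(3) assms(4) inc_sym B] z(2) \<open>z \<noteq> y\<close> False by blast
  qed
qed (use assms(1) in \<open>simp add: linked_def\<close>)

end

sublocale two_large_faces \<subseteq> swapped: two_large_faces inc t s
  using large_s large_t faces_neq by unfold_locales auto

context two_large_faces
begin

lemma swapped_linked: "swapped.linked w y \<longleftrightarrow> linked y w"
  unfolding linked_def swapped.linked_def using adj_sym by blast

lemma swapped_mid: "swapped.mid y \<longleftrightarrow> mid y"
  unfolding mid_def swapped.mid_def swapped_linked by blast

definition strip :: "'v \<Rightarrow> bool" where
  "strip v \<longleftrightarrow> rim v \<or> swapped.rim v \<or> mid v"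

lemma mid_neighbour:
  assumes "mid y" "adj y v" "\<not> on s v" "\<not> on t v"
  shows "mid v"
proof -
  have step: "linked y v" if "linked y w" for w
    using tip_if_neighbour_linked[OF that assms(2-4)] that assms(2,3) unfolding linked_def by blast
  have "swapped.linked y v" if "swapped.linked y w" for w
    using swapped.tip_if_neighbour_linked[OF that assms(2,4,3)] that assms(2,4)
    unfolding swapped.linked_def by blast
  then show ?thesis using step assms(1) unfolding mid_def swapped_linked by blast
qed

lemma linked_if_tip_near:
  assumes "tip s y" "\<not> on t y" "on t z" "adj y z"
  obtains w where "linked y w"
proof (cases "tip t y")
  case True
  then show thesis using that assms tip_off unfolding linked_def by blast
next
  case False
  obtain b where b: "adj y b" "tip t b"
    using neighbour_not_tip[OF large_t assms(3) adj_sym[OF assms(4)] assms(2) False] .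
  then have "\<not> on s b"
    using swapped.tip_beside_off_vertex(1)[OF b(2) adj_sym[OF b(1)]] assms(1,2) tip_off by blast
  then show thesis using that assms(1,2) b unfolding linked_def by blast
qed

end

text \<open>The locale is reopened to make the facts proved so far available in swapped form.\<close>

context two_large_faces
begin

lemma tip_if_between:
  assumes y: "\<not> on s y" "\<not> on t y" and x: "on s x" "adj y x" and z: "on t z" "adj y z"
  shows "tip s y \<or> tip t y"
proof (rule ccontr)
  assume "\<not> ?thesis"
  then have not_tip: "\<not> tip s y" "\<not> tip t y" by auto
  obtain b c u where b: "adj y b" "tip s b"
    and c: "adj y c" "c \<noteq> b" "\<not> on s c" "on s u" "adj c u"
    using neighbour_not_tip[OF large_s x(1) adj_sym[OF x(2)] y(1) not_tip(1)] .
  obtain b' where b': "adj y b'" "adj z b'" "tip t b'"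
    using neighbour_not_tip[OF large_t z(1) adj_sym[OF z(2)] y(2) not_tip(2)] .
  have off: "\<not> on s b" "\<not> on t b" "\<not> tip t b" "\<not> on t b'" "\<not> on s b'" "\<not> tip s b'"
    using tip_beside_off_vertex[OF b(2) adj_sym[OF b(1)] y] tip_off[OF b(2)] tip_off[OF b'(3)]
      swapped.tip_beside_off_vertex[OF b'(3) adj_sym[OF b'(1)] y(2,1)] by auto
  then have "distinct [x, z, b, b']" using x z b b' no_common_vertex by auto
  then have "{v. adj y v} = {x, z, b, b'}" using neighbours_eq x z b b' by blast
  then have "c \<in> {x, z, b, b'}" using c(1) by blast
  then have "c = z \<or> c = b'" using c x(1) by blast
  then show False
  proof
    assume "c = b'"
    then obtain w where "swapped.linked c w"
      using swapped.linked_if_tip_near[of c u] b'(3) off(5) c by blast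
    then have "tip s y"
      using swapped.tip_if_neighbour_linked[of c w y] c(1) adj_sym y by blast
    then show False using not_tip by blast
  next
    assume "c = z"
    obtain p q where pq: "p \<noteq> q" "on t p" "on t q" "adj z p" "adj z q"
      using attached_if_on[OF z(1)] unfolding attached_def by blast
    have "distinct [y, b', p, q]" using pq b' not_tip y off by auto
    then have "{v. adj z v} = {y, b', p, q}"
      using neighbours_eq[of z y b' p q] adj_sym[OF z(2)] b'(2) pq by blast
    then have "u \<in> {y, b', p, q}" using c(5) \<open>c = z\<close> by blast
    then show False using c(4) y off pq no_common_vertex by blast
  qed
qed

lemma mid_if_between:
  assumes y: "\<not> on s y" "\<not> on t y" and x: "on s x" "adj y x" and z: "on t z" "adj y z"
  shows "mid y"
  using tip_if_between[OF assms]
proof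
  assume "tip s y"
  then show ?thesis using linked_if_tip_near[OF _ y(2) z] unfolding mid_def by blast
next
  assume "tip t y"
  then show ?thesis
    using swapped.linked_if_tip_near[OF _ y(1) x] unfolding mid_def swapped_linked by blast
qed

lemma across_neighbour:
  assumes "across a" "adj a c" "\<not> on s c" "on s x" "adj c x"
  shows "across c"
proof (cases "on t c")
  case False
  then show ?thesis
    using assms mid_neighbour mid_if_between[OF assms(3) False assms(4,5)] adj_sym
    unfolding across_def by blast
qed (simp add: across_def)

lemma rim_along_boundary:
  assumes rot: "rotation x s p A a B b C q" and a: "across a"
  shows "rim p"
proof -
  have inc: "inc s x p" "inc A x p" "inc A x a" "p \<noteq> a" "A \<noteq> s"
    using rot unfolding rotation_def by auto
  have on: "on s x" "on s p" using onI[OF inc(1)] .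
  have "deg A = 3 \<or> deg A = 4"
    using degree_beside_large[OF large_s on(1) onI(1)[OF inc(2)] inc(5)] .
  then show ?thesis
  proof
    assume "deg A = 3"
    then have "inc A p a" using triangle_edge inc by blast
    then show ?thesis using a on adjI unfolding rim_def by blast
  next
    assume "deg A = 4"
    then obtain c where c: "c \<notin> {x, p, a}" "inc A p c" "inc A a c"
      using square_corner[OF _ inc(2-4)] by blast
    have "\<not> on s c"
      using off_if_beyond_common_edge[OF inc(1,2) inc(5)[symmetric] onI(2)[OF c(2)]] c(1) by blast
    then have "across c"
      using across_neighbour[OF a adjI[OF c(3)] _ on(2) adjI[OF inc_sym[OF c(2)]]] by blast
    then show ?thesis using on(2) adjI[OF c(2)] unfolding rim_def by blast
  qed
qed

lemma across_square:
  assumes rot: "rotation x s p A a B b C q" and a: "across a" and "deg B = 4"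
  shows "across b"
proof -
  have inc: "inc s x p" "inc B x a" "inc B x b" "a \<noteq> b" "B \<noteq> s"
    using rot unfolding rotation_def by auto
  have x: "on s x" "adj b x" using onI[OF inc(1)] adjI[OF inc_sym[OF inc(3)]] by auto
  have off: "\<not> on s b" using rotation_off[OF rot] by auto
  obtain c where c: "c \<notin> {x, a, b}" "inc B a c" "inc B b c"
    using square_corner[OF \<open>deg B = 4\<close> inc(2-4)] .
  have "\<not> on s c"
  proof
    assume "on s c"
    then have "inc B x c"
      using common_edge[OF inc(5), of x c] c x onI[OF c(2)] onI[OF inc(2)] by blast
    then show False using neighbours_on_face[OF inc(2,3,4)] c(1) by blast
  qed
  have "deg A = 3" "deg C = 3" using degrees_around_large[OF large_s rot] \<open>deg B = 4\<close> by auto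
  then have tips: "tip s a" "tip s b"
    using tip_of_rotation[OF rot] tip_of_rotation[OF rotation_reverse[OF rot]] by auto
  consider (b_on_t) "on t b" | (c_on_t) "\<not> on t b" "on t c" | (off_t) "\<not> on t b" "\<not> on t c" by blast
  then show ?thesis
  proof cases
    case b_on_t
    then show ?thesis by (simp add: across_def)
  next
    case c_on_t
    then show ?thesis using mid_if_between[OF off _ x] adjI[OF c(3)] unfolding across_def by blast
  next
    case off_t
    have "\<not> on t a"
      using tip_beside_off_vertex(1)[OF tips(1) adjI[OF c(2)] \<open>\<not> on s c\<close> off_t(2)] .
    then obtain w where "linked a w"
      using a tips(1) unfolding across_def mid_def linked_def by blast
    then have "tip t c"
      using tip_if_neighbour_linked[OF _ adjI[OF c(2)] \<open>\<not> on s c\<close> off_t(2)] by blast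
    then have "linked b c"
      using tips(2) off_t \<open>\<not> on s c\<close> adjI[OF c(3)] unfolding linked_def by blast
    then show ?thesis unfolding across_def mid_def by blast
  qed
qed

lemma across_rotation:
  assumes rot: "rotation x s p A a B b C q" and a: "across a"
  shows "across b"
proof -
  have inc: "inc s x p" "inc B x a" "inc B x b" "a \<noteq> b" "B \<noteq> s"
    using rot unfolding rotation_def by auto
  have x: "on s x" "adj b x" using onI[OF inc(1)] adjI[OF inc_sym[OF inc(3)]] by auto
  have "deg B = 3 \<or> deg B = 4"
    using degree_beside_large[OF large_s x(1) onI(1)[OF inc(2)] inc(5)] .
  then show ?thesis
  proof
    assume "deg B = 3"
    then have "adj a b" using adjI[OF triangle_edge[OF _ inc(2,3,4)]] by blast
    then show ?thesis using across_neighbour[OF a _ rotation_off(2)[OF rot] x] by blast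
  qed (rule across_square[OF rot a])
qed

lemma strip_neighbour_of_mid: "mid y \<Longrightarrow> adj y v \<Longrightarrow> strip v"
  using mid_neighbour adj_sym
  unfolding strip_def rim_def swapped.rim_def across_def swapped.across_def swapped_mid by blast

lemma strip_neighbour_of_rim:
  assumes "rim x" "adj x v" shows "strip v"
proof -
  obtain a where x: "on s x" and a: "adj x a" "across a" using assms(1) unfolding rim_def by blast
  obtain p A B b C q where rot: "rotation x s p A a B b C q"
    using rotation_from_face[OF x a(1) across_off[OF a(2)]] .
  have b: "across b" using across_rotation[OF rot a(2)] .
  have "rim p" "rim q"
    using rim_along_boundary[OF rot a(2)] rim_along_boundary[OF rotation_reverse[OF rot] b] .
  moreover have "strip c" if "across c" "adj x c" for c
    using that x adj_sym unfolding strip_def swapped.rim_def across_def swapped.across_def by blast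
  moreover have "v \<in> {p, a, b, q}" using rotation_neighbours[OF rot] assms(2) by blast
  ultimately show ?thesis using a(2) b assms(2) unfolding strip_def by blast
qed

end

context two_large_faces
begin

lemma swapped_strip: "swapped.strip v \<longleftrightarrow> strip v"
  unfolding strip_def swapped.strip_def swapped_mid by blast

lemma strip_neighbour: "strip v \<Longrightarrow> adj v w \<Longrightarrow> strip w"
  using strip_neighbour_of_mid strip_neighbour_of_rim swapped.strip_neighbour_of_rim
  unfolding swapped_strip strip_def[of v] by blast

lemma strip_reachable: "adj\<^sup>*\<^sup>* v w \<Longrightarrow> strip v \<Longrightarrow> strip w"
  by (induction rule: rtranclp_induct) (auto intro: strip_neighbour)

lemma strip_near:
  assumes "strip v" shows "near s v \<or> near t v"
proof -
  have "near f v" if "tip f v" for f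
    using attached_if_tip[OF that] unfolding attached_def near_def by blast
  then show ?thesis
    using assms unfolding strip_def rim_def swapped.rim_def mid_def linked_def near_def by blast
qed

lemma finite_strip: "finite {v. strip v}"
proof (rule finite_subset)
  show "{v. strip v} \<subseteq> {v. near s v} \<union> {v. near t v}" using strip_near by blast
qed (simp add: finite_near)

lemma strip_if_near_both:
  assumes "near s v" "near t v" shows "strip v"
proof -
  consider (on_s) "on s v" | (on_t) "on t v" | (off) "\<not> on s v" "\<not> on t v" by blast
  then show ?thesis
  proof cases
    case on_s
    then have "rim v" using assms(2) no_common_vertex unfolding near_def rim_def across_def by blast
    then show ?thesis unfolding strip_def by blast
  next
    case on_t
    then have "swapped.rim v"
      using assms(1) no_common_vertex unfolding near_def swapped.rim_def swapped.across_def by blast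
    then show ?thesis unfolding strip_def by blast
  next
    case off
    then have "mid v" using assms mid_if_between[OF off] unfolding near_def by blast
    then show ?thesis unfolding strip_def by blast
  qed
qed

theorem not_near_both:
  assumes connected: "\<And>x y. x \<in> verts \<Longrightarrow> y \<in> verts \<Longrightarrow> adj\<^sup>*\<^sup>* x y" and "infinite verts"
  shows "\<not> (near s v \<and> near t v)"
proof
  assume "near s v \<and> near t v"
  then have v: "strip v" using strip_if_near_both by blast
  then have "verts \<subseteq> {x. strip x}"
    using strip_reachable[OF connected v] near_in_verts strip_near by blast
  then show False using \<open>infinite verts\<close> finite_strip finite_subset by blast
qed

end

section \<open>The incidence structure of a tessellation\<close>

context plane_graph
begin

lemma edge_compact: "e \<in> E \<Longrightarrow> compact e"
  by (metis edge_arc compact_arc_image)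

lemma card_edge_vertices: "e \<in> E \<Longrightarrow> card (e \<inter> V) = 2"
  using edge_arc arc_distinct_ends by (metis card_2_iff)

lemma finite_edge_vertices: "e \<in> E \<Longrightarrow> finite (e \<inter> V)"
  using card_edge_vertices by (simp add: card_ge_0_finite)

lemma edge_other_vertex:
  assumes "e \<in> E" "x \<in> e" "x \<in> V" obtains y where "e \<inter> V = {x, y}" "x \<noteq> y"
proof -
  obtain y where "y \<in> e \<inter> V" "y \<noteq> x"
    using card_2_other[OF card_edge_vertices[OF assms(1)]] assms(2,3) by blast
  then show thesis
    using that eq_doubleton_if_card_2[OF card_edge_vertices[OF assms(1)], of x y] assms(2,3)
    by blast
qed

lemma edge_interior:
  assumes "e \<in> E" shows "connected (e - V)" "e \<subseteq> closure (e - V)"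
proof -
  obtain g where "arc g" and image: "path_image g = e" and "e \<inter> V = {pathstart g, pathfinish g}"
    using edge_arc[OF assms] by blast
  then have simple: "simple_path g" and V: "e - V = path_image g - {pathstart g, pathfinish g}"
    using arc_imp_simple_path by blast+
  show "connected (e - V)" unfolding V by (rule connected_simple_path_endless[OF simple])
  have interior: "e - V = g ` {0<..<1}" unfolding V by (rule simple_path_endless[OF simple])
  have "continuous_on (closure {0<..<1}) g"
    using \<open>arc g\<close> by (simp add: arc_def path_def)
  then have "g ` closure {0<..<1} \<subseteq> closure (e - V)"
    unfolding interior by (intro image_closure_subset closure_subset) auto
  then show "e \<subseteq> closure (e - V)" using image by (simp add: path_image_def)
qed

lemma edge_interiors_disjoint: "disjoint ((\<lambda>e. e - V) ` E)"
  using edge_inter by (intro disjointI) blast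

lemma inj_on_edge_interior: "inj_on (\<lambda>e. e - V) E"
proof (rule inj_onI)
  fix e e' assume e: "e \<in> E" "e' \<in> E" "e - V = e' - V"
  have "e \<noteq> {}" using card_edge_vertices[OF e(1)] by auto
  then have "e - V \<noteq> {}" using edge_interior(2)[OF e(1)] by (metis closure_empty subset_empty)
  then show "e = e'" using edge_inter[OF e(1,2)] e(3) by blast
qed

lemma closed_Union_edges: "closed (\<Union>E)"
proof -
  have "locally_finite_in euclidean E"
    unfolding locally_finite_in_def
  proof (intro conjI ballI)
    fix p :: complex
    obtain r where "r > 0" "finite {e \<in> E. e \<inter> ball p r \<noteq> {}}" using locally_finite by blast
    then show "\<exists>U. openin euclidean U \<and> p \<in> U \<and> finite {e \<in> E. e \<inter> U \<noteq> {}}"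
      by (intro exI[of _ "ball p r"]) auto
  qed auto
  then show ?thesis
    using closedin_locally_finite_Union[of E euclidean] edge_compact compact_imp_closed by auto
qed

lemma vertex_apart_from_other_edges:
  assumes "D \<subseteq> E" "finite D"
  shows "x \<notin> closure (\<Union>D - insert x (\<Union>((\<lambda>e. e - V) ` {e \<in> D. x \<in> e})))"
proof -
  have other_edges: "closed (\<Union>(D - {e \<in> D. x \<in> e}))"
    using assms edge_compact by (intro closed_Union) (auto intro: compact_imp_closed)
  have other_ends: "finite (\<Union>e\<in>{e \<in> D. x \<in> e}. e \<inter> V - {x})"
    using assms finite_edge_vertices by (intro finite_UN_I) auto
  let ?K = "\<Union>(D - {e \<in> D. x \<in> e}) \<union> (\<Union>e\<in>{e \<in> D. x \<in> e}. e \<inter> V - {x})"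
  have "\<Union>D - insert x (\<Union>((\<lambda>e. e - V) ` {e \<in> D. x \<in> e})) \<subseteq> ?K" by blast
  then have "closure (\<Union>D - insert x (\<Union>((\<lambda>e. e - V) ` {e \<in> D. x \<in> e}))) \<subseteq> ?K"
    by (rule closure_minimal[OF _ closed_Un[OF other_edges finite_imp_closed[OF other_ends]]])
  then show ?thesis by blast
qed

lemma inj_on_edge_vertices: "inj_on (\<lambda>e. e \<inter> V) E"
  using edge_unique by (auto simp: inj_on_def)

lemma card_neighbours_along_edges:
  assumes "D \<subseteq> E" "x \<in> V"
  shows "card {y. \<exists>e\<in>D. e \<inter> V = {x, y}} = card {e \<in> D. x \<in> e}"
proof -
  have "(\<lambda>y. {x, y}) ` {y. \<exists>e\<in>D. e \<inter> V = {x, y}} = (\<lambda>e. e \<inter> V) ` {e \<in> D. x \<in> e}"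
  proof (intro equalityI subsetI)
    fix P assume "P \<in> (\<lambda>y. {x, y}) ` {y. \<exists>e\<in>D. e \<inter> V = {x, y}}"
    then obtain y e where e: "P = {x, y}" "e \<in> D" "e \<inter> V = {x, y}" by blast
    then have "x \<in> e" by blast
    then show "P \<in> (\<lambda>e. e \<inter> V) ` {e \<in> D. x \<in> e}" using e by (simp add: image_iff) metis
  next
    fix P assume "P \<in> (\<lambda>e. e \<inter> V) ` {e \<in> D. x \<in> e}"
    then obtain e where e: "P = e \<inter> V" "e \<in> D" "x \<in> e" by blast
    then obtain y where "e \<inter> V = {x, y}" using edge_other_vertex assms by blast
    then show "P \<in> (\<lambda>y. {x, y}) ` {y. \<exists>e\<in>D. e \<inter> V = {x, y}}" using e by blast
  qed
  moreover have "inj_on (\<lambda>y. {x, y}) {y. \<exists>e\<in>D. e \<inter> V = {x, y}}"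
    by (intro inj_onI) (metis doubleton_eq_iff)
  moreover have "inj_on (\<lambda>e. e \<inter> V) {e \<in> D. x \<in> e}"
    by (rule inj_on_subset[OF inj_on_edge_vertices]) (use assms(1) in blast)
  ultimately show ?thesis by (metis (lifting) card_image)
qed

end

context infinite_planar_tessellation
begin

lemma vertex_on_edge:
  assumes "x \<in> V" obtains e where "e \<in> E" "x \<in> e"
proof -
  have "card {e \<in> E. x \<in> e} \<noteq> 0"
    using vertex_degree_ge_3[OF assms] by (simp add: vertex_degree_def)
  then have "{e \<in> E. x \<in> e} \<noteq> {}" by (metis card.empty)
  then show thesis using that by blast
qed

lemma face_open: "\<sigma> \<in> faces V E \<Longrightarrow> open \<sigma>"
proof -
  have "V \<union> \<Union>E = \<Union>E" using vertex_on_edge by blast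
  then have "open (- (V \<union> \<Union>E))" using closed_Union_edges by (simp add: open_Compl)
  then show "\<sigma> \<in> faces V E \<Longrightarrow> open \<sigma>" unfolding faces_def using open_components by blast
qed

lemma face_inter_closure_eq_empty:
  assumes "\<sigma> \<in> faces V E" "\<tau> \<in> faces V E" "\<sigma> \<noteq> \<tau>"
  shows "\<sigma> \<inter> closure \<tau> = {}"
proof -
  have "\<sigma> \<inter> \<tau> = {}" using assms components_nonoverlap unfolding faces_def by blast
  then show ?thesis using open_Int_closure_eq_empty[OF face_open[OF assms(1)]] by blast
qed

lemma vertex_on_frontier:
  assumes "\<sigma> \<in> faces V E" "x \<in> V" "x \<in> closure \<sigma>"
  shows "x \<in> frontier (closure \<sigma>)"
proof (rule ccontr)
  assume "\<not> ?thesis"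
  then have interior: "x \<in> interior (closure \<sigma>)" using assms(3) by (simp add: frontier_def)
  obtain e where e: "e \<in> E" "x \<in> e" using vertex_on_edge[OF assms(2)] .
  have "\<exists>\<tau>. \<tau> \<noteq> \<sigma> \<and> \<tau> \<in> {\<tau> \<in> faces V E. e \<subseteq> closure \<tau>}"
    using edge_two_faces[OF e(1)] by (metis card_2_iff insertCI)
  then obtain \<tau> where \<tau>: "\<tau> \<noteq> \<sigma>" "\<tau> \<in> faces V E" "x \<in> closure \<tau>" using e(2) by blast
  have "interior (closure \<sigma>) \<inter> \<tau> \<noteq> {}"
    using open_Int_closure_eq_empty[of "interior (closure \<sigma>)" \<tau>] interior \<tau>(3) by auto
  then have "\<tau> \<inter> closure \<sigma> \<noteq> {}" using interior_subset by blast
  then show False using face_inter_closure_eq_empty[OF \<tau>(2) assms(1) \<tau>(1)] by simp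
qed

lemma boundary_edges_subset: "boundary_edges E \<sigma> \<subseteq> E"
  by (auto simp: boundary_edges_def)

lemma card_boundary_edges_at_vertex:
  assumes \<sigma>: "\<sigma> \<in> faces V E" and x: "x \<in> face_vertices V \<sigma>"
  shows "card {e \<in> boundary_edges E \<sigma>. x \<in> e} = 2"
proof -
  let ?F = "frontier (closure \<sigma>)" and ?D = "{e \<in> boundary_edges E \<sigma>. x \<in> e}"
  have F: "?F = \<Union>(boundary_edges E \<sigma>)" and fin: "finite (boundary_edges E \<sigma>)"
    using face_bounded_by_edges[OF \<sigma>] by auto
  have "x \<in> V" and xF: "x \<in> ?F" using vertex_on_frontier[OF \<sigma>] x by (auto simp: face_vertices_def)
  then obtain e\<^sub>0 where e\<^sub>0: "e\<^sub>0 \<in> boundary_edges E \<sigma>" "x \<in> e\<^sub>0" unfolding F by blast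
  then have "e\<^sub>0 \<in> E" using boundary_edges_subset by blast
  then obtain a where a: "e\<^sub>0 \<inter> V = {x, a}" "x \<noteq> a"
    using edge_other_vertex e\<^sub>0(2) \<open>x \<in> V\<close> by blast
  have subset: "?D \<subseteq> E" using boundary_edges_subset by blast
  have inj: "inj_on (\<lambda>e. e - V) ?D"
    using inj_on_subset[OF inj_on_edge_interior subset] .
  have "card ((\<lambda>e. e - V) ` ?D) = 2"
  proof (rule card_arcs_ending_at_circle_point)
    have "?F homeomorphic frontier (cball (0::complex) 1)"
      by (rule homeomorphic_frontiers_same_dimension[OF face_disk[OF \<sigma>]]) auto
    then show "?F homeomorphic sphere (0::complex) 1" by simp
    show "a \<in> ?F" using a(1) e\<^sub>0(1) unfolding F by blast
    show "connected C \<and> x \<in> closure C \<and> C \<subseteq> ?F - {a, x}" if "C \<in> (\<lambda>e. e - V) ` ?D" for C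
    proof -
      obtain e where e: "e \<in> boundary_edges E \<sigma>" "x \<in> e" "C = e - V" using \<open>C \<in> _\<close> by blast
      then have "e \<in> E" using boundary_edges_subset by blast
      then have "connected C" "x \<in> closure C" using edge_interior e(2,3) by blast+
      moreover have "C \<subseteq> ?F" using e(1,3) unfolding F by blast
      moreover have "a \<in> V" using a(1) by blast
      ultimately show ?thesis using e(3) \<open>x \<in> V\<close> by blast
    qed
    show "disjoint ((\<lambda>e. e - V) ` ?D)"
      by (rule pairwise_subset[OF edge_interiors_disjoint image_mono[OF subset]])
    show "x \<notin> closure (?F - insert x (\<Union>((\<lambda>e. e - V) ` ?D)))"
      unfolding F by (rule vertex_apart_from_other_edges[OF boundary_edges_subset fin])
  qed (fact xF a(2))+
  then show ?thesis using card_image[OF inj] by simp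
qed

lemma finite_face_vertices:
  assumes "\<sigma> \<in> faces V E" shows "finite (face_vertices V \<sigma>)"
proof -
  have "face_vertices V \<sigma> \<subseteq> (\<Union>e\<in>boundary_edges E \<sigma>. e \<inter> V)"
    using vertex_on_frontier[OF assms] face_bounded_by_edges[OF assms]
    by (auto simp: face_vertices_def)
  moreover have "finite (e \<inter> V)" if "e \<in> boundary_edges E \<sigma>" for e
    using that finite_edge_vertices boundary_edges_subset by blast
  ultimately show ?thesis using face_bounded_by_edges[OF assms] by (meson finite_UN_I finite_subset)
qed

lemma card_face_vertices:
  assumes "\<sigma> \<in> faces V E" shows "card (face_vertices V \<sigma>) = face_degree E \<sigma>"
  unfolding face_degree_def
proof (rule card_eq_if_biregular[where R = "(\<in>)" and k = 2])
  show "card {x \<in> face_vertices V \<sigma>. x \<in> e} = 2" if "e \<in> boundary_edges E \<sigma>" for e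
  proof -
    have "{x \<in> face_vertices V \<sigma>. x \<in> e} = e \<inter> V"
      using that by (auto simp: face_vertices_def boundary_edges_def)
    then show ?thesis using card_edge_vertices that boundary_edges_subset by auto
  qed
qed (use assms in \<open>simp_all add: finite_face_vertices face_bounded_by_edges
    card_boundary_edges_at_vertex\<close>)

lemma infinite_vertices: "infinite V"
proof
  assume fin: "finite V"
  have "(\<lambda>e. e \<inter> V) ` E \<subseteq> Pow V" by auto
  then have "finite E"
    using inj_on_edge_vertices fin by (meson finite_Pow_iff finite_imageD finite_subset)
  then have "bounded (V \<union> \<Union>E)"
    using finite_imp_bounded[OF fin] bounded_Union[of E] edge_compact compact_imp_bounded
    by (meson bounded_Un)
  then obtain \<sigma> where \<sigma>: "\<sigma> \<in> faces V E" "\<not> bounded \<sigma>"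
    using cobounded_unbounded_components[of "- (V \<union> \<Union>E)"] unfolding faces_def by auto
  have "compact (closure \<sigma>)"
    using face_disk[OF \<sigma>(1)] homeomorphic_compactness compact_cball by blast
  then show False using \<sigma>(2) compact_imp_bounded bounded_subset closure_subset by blast
qed

definition incident :: "complex set \<Rightarrow> complex \<Rightarrow> complex \<Rightarrow> bool" where
  "incident \<sigma> x y \<longleftrightarrow> \<sigma> \<in> faces V E \<and> (\<exists>e\<in>boundary_edges E \<sigma>. e \<inter> V = {x, y})"

sublocale face_incidence incident
proof
  show "incident \<sigma> y x" if "incident \<sigma> x y" for \<sigma> x y
    using that unfolding incident_def by (metis insert_commute)
  show "\<not> incident \<sigma> x x" for \<sigma> x
    using card_edge_vertices boundary_edges_subset unfolding incident_def by fastforce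
qed

lemma on_iff: "on \<sigma> x \<longleftrightarrow> \<sigma> \<in> faces V E \<and> x \<in> face_vertices V \<sigma>"
proof
  assume "on \<sigma> x"
  then obtain y e where "\<sigma> \<in> faces V E" "e \<subseteq> closure \<sigma>" "e \<inter> V = {x, y}"
    unfolding on_def incident_def boundary_edges_def by blast
  then show "\<sigma> \<in> faces V E \<and> x \<in> face_vertices V \<sigma>" unfolding face_vertices_def by blast
next
  assume \<sigma>: "\<sigma> \<in> faces V E \<and> x \<in> face_vertices V \<sigma>"
  then have "x \<in> \<Union>(boundary_edges E \<sigma>)"
    using vertex_on_frontier face_bounded_by_edges by (simp add: face_vertices_def)
  then obtain e where e: "e \<in> boundary_edges E \<sigma>" "e \<in> E" "x \<in> e"
    using boundary_edges_subset by blast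
  then obtain y where "e \<inter> V = {x, y}"
    using edge_other_vertex[OF e(2,3)] \<sigma> by (auto simp: face_vertices_def)
  then show "on \<sigma> x" using e(1) \<sigma> unfolding on_def incident_def by blast
qed

lemma deg_eq_face_degree:
  assumes "\<sigma> \<in> faces V E" shows "deg \<sigma> = face_degree E \<sigma>"
proof -
  have "{x. on \<sigma> x} = face_vertices V \<sigma>" using assms by (auto simp: on_iff)
  then show ?thesis unfolding deg_def by (simp add: card_face_vertices[OF assms])
qed

lemma incident_edge_iff:
  assumes "e \<in> E" "e \<inter> V = {x, y}"
  shows "incident \<sigma> x y \<longleftrightarrow> \<sigma> \<in> faces V E \<and> e \<subseteq> closure \<sigma>"
proof
  assume "incident \<sigma> x y"
  then obtain d where "\<sigma> \<in> faces V E" "d \<in> E" "d \<subseteq> closure \<sigma>" "d \<inter> V = {x, y}"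
    unfolding incident_def boundary_edges_def by blast
  then show "\<sigma> \<in> faces V E \<and> e \<subseteq> closure \<sigma>" using edge_unique[OF assms(1)] assms(2) by metis
qed (use assms in \<open>auto simp: incident_def boundary_edges_def\<close>)

lemma adj_iff: "adj x y \<longleftrightarrow> (\<exists>e\<in>E. e \<inter> V = {x, y})"
proof
  assume "\<exists>e\<in>E. e \<inter> V = {x, y}"
  then obtain e where e: "e \<in> E" "e \<inter> V = {x, y}" by blast
  have "card {\<sigma> \<in> faces V E. e \<subseteq> closure \<sigma>} \<noteq> 0" using edge_two_faces[OF e(1)] by simp
  then have "{\<sigma> \<in> faces V E. e \<subseteq> closure \<sigma>} \<noteq> {}" by (metis card.empty)
  then show "adj x y" using incident_edge_iff[OF e] unfolding adj_def by blast
qed (auto simp: adj_def incident_def boundary_edges_def)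

lemma adj_eq_adjacent: "adj = adjacent V E"
proof (intro ext)
  show "adj x y \<longleftrightarrow> adjacent V E x y" for x y
    using adj_iff[of x y] inc_neq unfolding adjacent_def adj_def by blast
qed

lemma verts_eq: "verts = V"
proof (intro equalityI subsetI)
  fix x assume "x \<in> V"
  then obtain e where e: "e \<in> E" "x \<in> e" by (rule vertex_on_edge)
  then obtain y where "e \<inter> V = {x, y}" using edge_other_vertex \<open>x \<in> V\<close> by blast
  then have "adj x y" using e(1) unfolding adj_iff by blast
  then show "x \<in> verts" using onI(1) unfolding adj_def verts_def by blast
qed (auto simp: verts_def on_iff face_vertices_def)

lemma common_edge_of_faces:
  assumes "\<sigma> \<noteq> \<tau>" "x \<noteq> y" "on \<sigma> x" "on \<tau> x" "on \<sigma> y" "on \<tau> y"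
  obtains e where "e \<in> E" "closure \<sigma> \<inter> closure \<tau> = e" "e \<inter> V = {x, y}"
proof -
  have xy: "x \<in> V" "y \<in> V" "x \<in> closure \<sigma> \<inter> closure \<tau>" "y \<in> closure \<sigma> \<inter> closure \<tau>"
    and faces: "\<sigma> \<in> faces V E" "\<tau> \<in> faces V E"
    using assms by (auto simp: on_iff face_vertices_def)
  have "closure \<sigma> \<inter> closure \<tau> \<noteq> {u}" for u
    using xy(3,4) assms(2) by (metis singletonD)
  then obtain e where e: "e \<in> E" "closure \<sigma> \<inter> closure \<tau> = e"
    using face_inter[OF faces assms(1)] xy(3) by (metis empty_iff)
  then have "e \<inter> V = {x, y}"
    using eq_doubleton_if_card_2[OF card_edge_vertices[OF e(1)], of x y] xy assms(2) by blast
  then show thesis using that e by blast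
qed

lemma card_incident:
  assumes "on \<sigma> x" shows "card {y. incident \<sigma> x y} = 2"
  using assms card_neighbours_along_edges[OF boundary_edges_subset, of x]
    card_boundary_edges_at_vertex
  unfolding on_iff incident_def by (simp add: face_vertices_def)

lemma card_incident_faces:
  assumes "incident \<sigma> x y" shows "card {\<tau>. incident \<tau> x y} = 2"
proof -
  obtain e where "e \<in> E" "e \<inter> V = {x, y}" using adjI[OF assms] unfolding adj_iff by blast
  then show ?thesis using edge_two_faces incident_edge_iff by simp
qed

lemma card_adj: "x \<in> V \<Longrightarrow> card {y. adj x y} = vertex_degree E x"
  using card_neighbours_along_edges[OF subset_refl] unfolding adj_iff vertex_degree_def by simp

lemma curvature_eq:
  assumes "x \<in> V"
  shows "curvature V E x = 1 - real (vertex_degree E x) / 2 + (\<Sum>\<sigma> | on \<sigma> x. 1 / real (deg \<sigma>))"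
  unfolding curvature_def
  by (intro arg_cong2[where f = plus] sum.cong refl)
    (use assms in \<open>auto simp: on_iff face_vertices_def deg_eq_face_degree\<close>)

lemma neighborhood1_iff_near:
  assumes "\<sigma> \<in> faces V E" shows "x \<in> neighborhood1 V E \<sigma> \<longleftrightarrow> near \<sigma> x"
proof -
  have "x \<in> V" if "adj x z" for z using that unfolding adj_iff by blast
  then show ?thesis
    unfolding neighborhood1_def near_def on_iff adj_eq_adjacent[symmetric] using assms by auto
qed

end

locale regular_nonneg_tessellation = infinite_planar_tessellation +
  assumes regular: "x \<in> V \<Longrightarrow> vertex_degree E x = 4"
    and curvature_nonneg: "x \<in> V \<Longrightarrow> curvature V E x \<ge> 0"
begin

sublocale nonneg_four_regular_map incident
proof
  show "card {y. incident \<sigma> x y} = 2" if "on \<sigma> x" for \<sigma> x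
    using card_incident[OF that] .
  show "card {\<tau>. incident \<tau> x y} = 2" if "incident \<sigma> x y" for \<sigma> x y
    using card_incident_faces[OF that] .
  show "card {z. adj x z} = 4" if "adj x y" for x y
    using that card_adj[of x] regular[of x] unfolding adj_iff by auto
  show "incident \<sigma> x y" if "\<sigma> \<noteq> \<tau>" "x \<noteq> y" "on \<sigma> x" "on \<tau> x" "on \<sigma> y" "on \<tau> y" for \<sigma> \<tau> x y
    using common_edge_of_faces[OF that] incident_edge_iff that(3) unfolding on_iff
    by (metis inf_le1)
  show "z = x \<or> z = y"
    if "\<sigma> \<noteq> \<tau>" "x \<noteq> y" "on \<sigma> x" "on \<tau> x" "on \<sigma> y" "on \<tau> y" "on \<sigma> z" "on \<tau> z" for \<sigma> \<tau> x y z
    using common_edge_of_faces[OF that(1-6)] that(7,8) unfolding on_iff face_vertices_def by blast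
  show "finite {x. on \<sigma> x}" for \<sigma>
    using finite_face_vertices by (cases "\<sigma> \<in> faces V E") (simp_all add: on_iff)
  show "1 \<le> (\<Sum>\<tau> | on \<tau> x. 1 / real (deg \<tau>))" if "on \<sigma> x" for \<sigma> x
  proof -
    have "x \<in> V" using that by (simp add: on_iff face_vertices_def)
    then show ?thesis using curvature_nonneg[of x] regular[of x] by (simp add: curvature_eq)
  qed
qed

end

theorem theorem4p1:
  fixes V :: "complex set" and E :: "complex set set"
    and \<sigma>\<^sub>1 \<sigma>\<^sub>2 :: "complex set" and k\<^sub>1 k\<^sub>2 :: nat
  assumes "infinite_planar_tessellation V E"
    and "\<forall>x\<in>V. vertex_degree E x = 4"
    and "\<forall>x\<in>V. curvature V E x \<ge> 0"
    and "\<sigma>\<^sub>1 \<in> faces V E" and "face_degree E \<sigma>\<^sub>1 = k\<^sub>1" and "k\<^sub>1 \<ge> 8"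
    and "\<sigma>\<^sub>2 \<in> faces V E" and "face_degree E \<sigma>\<^sub>2 = k\<^sub>2" and "k\<^sub>2 \<ge> 8"
    and "\<sigma>\<^sub>1 \<noteq> \<sigma>\<^sub>2"
  shows "neighborhood1 V E \<sigma>\<^sub>1 \<inter> neighborhood1 V E \<sigma>\<^sub>2 = {}"
proof -
  interpret infinite_planar_tessellation V E by fact
  interpret regular_nonneg_tessellation V E
    using assms(2,3) by unfold_locales auto
  interpret two_large_faces incident \<sigma>\<^sub>1 \<sigma>\<^sub>2
    using assms(4-10) by unfold_locales (simp_all add: large_def deg_eq_face_degree)
  show ?thesis
    using not_near_both connected_graph infinite_vertices neighborhood1_iff_near assms(4,7)
    unfolding verts_eq adj_eq_adjacent by (metis disjoint_iff)
qed

end
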